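(* Let $\mathfrak{o}$ be a norm-finite Dedekind domain, $U=\mathrm{GL}_2(\mathfrak{o})$, and let $m\in\mathfrak{o}$ with $m\neq0$. Let $U^0[m]=\left\{\begin{pmatrix}a&b\\c&d\end{pmatrix}\in U \;\middle|\; b\in m\mathfrak{o}\right\}$. Then the index of the subgroup $U^0[m]$ in $U$ is $$[U:U^0[m]]=\mathrm{N}(m\mathfrak{o})\prod_{\substack{\mathfrak{p}\text{ prime ideal}\\ \mathfrak{p}\mid m}}\bigl(1+\mathrm{N}(\mathfrak{p})^{-1}\bigr).$$
   Context: A Dedekind domain $\mathfrak{o}$ is called norm-finite if $|\mathfrak{o}/a\mathfrak{o}|<\infty$ for every nonzero $a\in\mathfrak{o}$. For a nonzero ideal $\mathfrak{a}$ of $\mathfrak{o}$, $\mathrm{N}(\mathfrak{a})=|\mathfrak{o}/\mathfrak{a}|$. Prime ideals are nonzero prime ideals of $\mathfrak{o}$, and $\mathfrak{p}\mid m$ means $m\in\mathfrak{p}$. *)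

theory Defs
  imports
    "HOL-Algebra.Ring_Divisibility"
    "HOL-Algebra.Left_Coset"
    "Jordan_Normal_Form.VS_Connect"
begin

text \<open>
  The ring \<open>\<oo>\<close> is a type \<open>'a\<close> of class \<^class>\<open>idom\<close>; its ideals and quotients are those of
  HOL-Algebra for the record \<^term>\<open>class_ring\<close>, whose carrier is the whole type.
\<close>

definition integral_elt :: "'a::idom fract \<Rightarrow> bool" where
  "integral_elt x \<longleftrightarrow> (\<exists>f :: 'a poly. lead_coeff f = 1 \<and> poly (map_poly to_fract f) x = 0)"

definition integrally_closed :: "'a::idom itself \<Rightarrow> bool" where
  "integrally_closed _ \<longleftrightarrow> (\<forall>x :: 'a fract. integral_elt x \<longrightarrow> x \<in> range to_fract)"

definition nonzero_primes :: "'a::idom set set" where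
  "nonzero_primes = {P. primeideal P class_ring \<and> P \<noteq> {0}}"

text \<open>Fields are not excluded.\<close>

definition dedekind_domain :: "'a::idom itself \<Rightarrow> bool" where
  "dedekind_domain T \<longleftrightarrow>
     noetherian_ring (class_ring :: 'a ring) \<and>
     integrally_closed T \<and>
     (\<forall>P \<in> (nonzero_primes :: 'a set set). maximalideal P class_ring)"

definition norm_finite :: "'a::idom itself \<Rightarrow> bool" where
  "norm_finite _ \<longleftrightarrow>
     (\<forall>a :: 'a. a \<noteq> 0 \<longrightarrow> finite (carrier (class_ring Quot (PIdl\<^bsub>class_ring\<^esub> a))))"

definition ideal_norm :: "'a::idom set \<Rightarrow> nat" where
  "ideal_norm I = card (carrier (class_ring Quot I))"

definition GL2 :: "'a::idom mat monoid" where
  "GL2 = units_of (ring_mat TYPE('a) 2 ())"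

text \<open>Matrix indices start at 0, so the upper right entry is at \<open>(0, 1)\<close>.\<close>

definition U0 :: "'a::idom \<Rightarrow> 'a mat set" where
  "U0 m = {A \<in> carrier GL2. A $$ (0, 1) \<in> PIdl\<^bsub>class_ring\<^esub> m}"

definition group_index :: "('g, 'b) monoid_scheme \<Rightarrow> 'g set \<Rightarrow> nat" where
  "group_index G H = card (lcosets\<^bsub>G\<^esub> H)"

lemma PIdl_class_ring: "PIdl\<^bsub>class_ring\<^esub> (m :: 'a::idom) = {x. m dvd x}"
  by (auto simp: cgenideal_def dvd_def mult.commute)

lemma group_GL2: "group (GL2 :: 'a::idom mat monoid)"
proof -
  interpret ring "ring_mat TYPE('a) 2 ()" by (rule ring_mat)
  show ?thesis unfolding GL2_def by (rule units_group)
qed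

lemma GL2_simps:
  "carrier (GL2 :: 'a::idom mat monoid) = Units (ring_mat TYPE('a) 2 ())"
  "mult (GL2 :: 'a mat monoid) = (*)"
  "one (GL2 :: 'a mat monoid) = 1\<^sub>m 2"
  by (simp_all add: GL2_def units_of_def ring_mat_simps)

lemma mat2_mult_entry:
  assumes "A \<in> carrier_mat 2 2" "B \<in> carrier_mat 2 2" "i < 2" "j < 2"
  shows "(A * B) $$ (i, j) = A $$ (i, 0) * B $$ (0, j) + A $$ (i, 1) * (B $$ (1, j) :: 'a::idom)"
  using assms by (auto simp: scalar_prod_def numeral_2_eq_2)

lemma subgroup_U0: "subgroup (U0 (m :: 'a::idom)) GL2"
proof -
  interpret group "GL2 :: 'a mat monoid" by (rule group_GL2)
  have C: "A \<in> carrier_mat 2 2" if "A \<in> carrier GL2" for A :: "'a mat"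
    using that by (auto simp: GL2_simps Units_def ring_mat_simps)
  show ?thesis
  proof (rule subgroupI)
    show "U0 m \<subseteq> carrier GL2" by (auto simp: U0_def)
    have "1\<^sub>m 2 \<in> U0 m"
      using one_closed by (auto simp: U0_def PIdl_class_ring GL2_simps)
    then show "U0 m \<noteq> {}" by blast
  next
    fix A assume A: "A \<in> U0 m"
    define B where "B = inv\<^bsub>GL2\<^esub> A"
    have AG: "A \<in> carrier GL2" and mA: "m dvd A $$ (0, 1)"
      using A by (auto simp: U0_def PIdl_class_ring)
    have BG: "B \<in> carrier GL2" using AG by (simp add: B_def)
    note Ac = C[OF AG] and Bc = C[OF BG]
    have AB: "A * B = 1\<^sub>m 2" using r_inv[OF AG] by (simp add: B_def GL2_simps)
    have e00: "A $$ (0,0) * B $$ (0,0) + A $$ (0,1) * B $$ (1,0) = 1"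
      using arg_cong[OF AB, of "\<lambda>M. M $$ (0,0)"] mat2_mult_entry[OF Ac Bc, of 0 0] by simp
    have e01: "A $$ (0,0) * B $$ (0,1) + A $$ (0,1) * B $$ (1,1) = 0"
      using arg_cong[OF AB, of "\<lambda>M. M $$ (0,1)"] mat2_mult_entry[OF Ac Bc, of 0 1] by simp
    have "B $$ (0,1) = (A $$ (0,0) * B $$ (0,0) + A $$ (0,1) * B $$ (1,0)) * B $$ (0,1)"
      using e00 by simp
    also have "\<dots> = B $$ (0,0) * (A $$ (0,0) * B $$ (0,1)) + A $$ (0,1) * (B $$ (1,0) * B $$ (0,1))"
      by (simp add: algebra_simps)
    also have "A $$ (0,0) * B $$ (0,1) = - (A $$ (0,1) * B $$ (1,1))"
      using e01 by (simp add: eq_neg_iff_add_eq_0)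
    finally have "B $$ (0,1) = A $$ (0,1) * (B $$ (1,0) * B $$ (0,1) - B $$ (0,0) * B $$ (1,1))"
      by (simp add: algebra_simps)
    then have "m dvd B $$ (0, 1)" using mA by (metis dvd_mult2)
    then show "inv\<^bsub>GL2\<^esub> A \<in> U0 m" using BG by (simp add: U0_def PIdl_class_ring B_def)
  next
    fix A B assume A: "A \<in> U0 m" and B: "B \<in> U0 m"
    then have AG: "A \<in> carrier GL2" and BG: "B \<in> carrier GL2"
      and "m dvd A $$ (0,1)" "m dvd B $$ (0,1)" by (auto simp: U0_def PIdl_class_ring)
    then have "m dvd (A * B) $$ (0,1)"
      using mat2_mult_entry[OF C C, of A B 0 1] by simp
    moreover have "A * B \<in> carrier GL2" using m_closed[OF AG BG] by (simp add: GL2_simps)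
    ultimately show "A \<otimes>\<^bsub>GL2\<^esub> B \<in> U0 m" by (simp add: U0_def PIdl_class_ring GL2_simps)
  qed
qed

lemma finite_nonzero_primes_dvd:
  assumes "norm_finite TYPE('a::idom)" and "(m :: 'a) \<noteq> 0"
  shows "finite {P \<in> nonzero_primes. m \<in> P}"
proof -
  let ?R = "class_ring :: 'a ring"
  let ?Q = "carrier (?R Quot (PIdl\<^bsub>?R\<^esub> m))"
  have fin: "finite (Pow ?Q)" using assms by (auto simp: norm_finite_def)
  have "P \<in> Union ` Pow ?Q" if P: "P \<in> nonzero_primes" and m: "m \<in> P" for P :: "'a set"
  proof -
    interpret ideal P ?R using P by (auto simp: nonzero_primes_def primeideal_def)
    have sub: "a + x \<in> P" if "x \<in> P" "m dvd a" for a x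
    proof -
      from that obtain k where "a = k * m" by (metis dvdE mult.commute)
      then have "a \<in> P" using I_l_closed[OF m, of k] by simp
      then show ?thesis using a_closed[OF _ \<open>x \<in> P\<close>, of a] by simp
    qed
    have car: "?Q = range (\<lambda>x. {a + x |a. m dvd a})"
      by (auto simp: FactRing_def A_RCOSETS_def' a_r_coset_def' PIdl_class_ring)
    have "P = \<Union> ((\<lambda>x. {a + x |a. m dvd a}) ` P)"
    proof
      show "P \<subseteq> \<Union> ((\<lambda>x. {a + x |a. m dvd a}) ` P)"
      proof
        fix x assume "x \<in> P"
        moreover have "x \<in> {a + x |a. m dvd a}" by (auto intro: exI[of _ 0])
        ultimately show "x \<in> \<Union> ((\<lambda>x. {a + x |a. m dvd a}) ` P)" by blast
      qed
      show "\<Union> ((\<lambda>x. {a + x |a. m dvd a}) ` P) \<subseteq> P" using sub by blast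
    qed
    moreover have "(\<lambda>x. {a + x |a. m dvd a}) ` P \<in> Pow ?Q" unfolding car by blast
    ultimately show ?thesis by (rule image_eqI)
  qed
  then have "{P \<in> nonzero_primes. m \<in> P} \<subseteq> Union ` Pow ?Q" by blast
  then show ?thesis using fin by (rule finite_surj[rotated])
qed

end

theory Submission
  imports Defs "HOL-Library.Product_Plus"
begin

text \<open>
  A left coset of \<open>U\<^sup>0[m]\<close> is determined by the second column of its members modulo \<open>m\<close>, up to
  a unit of \<open>\<oo>/m\<close>. Every column that is unimodular modulo \<open>m\<close> lifts to a unimodular one over \<open>\<oo>\<close>,
  and the units of \<open>\<oo>/m\<close> act freely on unimodular columns. Hence the index times the number of
  units of \<open>\<oo>/m\<close> is the number of unimodular pairs over \<open>\<oo>/m\<close>. Being a unit, or a unimodular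
  pair, means avoiding \<open>\<pp>\<close>, or \<open>\<pp> \<times> \<pp>\<close>, for each of the finitely many primes \<open>\<pp>\<close> containing \<open>m\<close>,
  and by the Chinese remainder theorem these conditions are independent. With \<open>N = N(m\<oo>)\<close> this gives
  \<open>N \<Prod>(1 - N(\<pp>)\<^sup>-\<^sup>1)\<close> units and \<open>N\<^sup>2 \<Prod>(1 - N(\<pp>)\<^sup>-\<^sup>2)\<close> pairs; the index is the quotient.
\<close>

subsection \<open>Cosets of additive subgroups\<close>

text \<open>Stated for type-class groups, so that one theory of cosets covers both the ring and,
  with componentwise operations, its square.\<close>

definition add_subgroup :: "'b::ab_group_add set \<Rightarrow> bool" where
  "add_subgroup H \<longleftrightarrow> 0 \<in> H \<and> (\<forall>x\<in>H. \<forall>y\<in>H. x - y \<in> H)"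

definition add_coset :: "'b::ab_group_add set \<Rightarrow> 'b \<Rightarrow> 'b set" where
  "add_coset H x = {y. y - x \<in> H}"

lemma add_subgroup_minus: "add_subgroup H \<Longrightarrow> x \<in> H \<Longrightarrow> - x \<in> H"
  unfolding add_subgroup_def by (metis diff_0)

lemma add_subgroup_add: "add_subgroup H \<Longrightarrow> x \<in> H \<Longrightarrow> y \<in> H \<Longrightarrow> x + y \<in> H"
  using add_subgroup_minus unfolding add_subgroup_def by (metis diff_minus_eq_add)

lemma add_subgroup_diff: "add_subgroup H \<Longrightarrow> x \<in> H \<Longrightarrow> y \<in> H \<Longrightarrow> x - y \<in> H"
  by (simp add: add_subgroup_def)

lemma add_subgroup_diff_iff:
  assumes "add_subgroup H" "x - y \<in> H"
  shows "x \<in> H \<longleftrightarrow> y \<in> H"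
  using add_subgroup_add[OF assms, of y] add_subgroup_diff[OF assms(1) _ assms(2), of x] by auto

lemma add_coset_self: "add_subgroup H \<Longrightarrow> x \<in> add_coset H x"
  by (simp add: add_subgroup_def add_coset_def)

lemma add_coset_eq_iff:
  assumes "add_subgroup H"
  shows "add_coset H x = add_coset H y \<longleftrightarrow> x - y \<in> H"
proof
  assume "add_coset H x = add_coset H y"
  then show "x - y \<in> H" using add_coset_self[OF assms, of x] by (simp add: add_coset_def)
next
  assume xy: "x - y \<in> H"
  have "z - x \<in> H \<longleftrightarrow> z - y \<in> H" for z
    using add_subgroup_diff_iff[OF assms, of "z - y" "z - x"] xy by simp
  then show "add_coset H x = add_coset H y" by (auto simp: add_coset_def)
qed

lemma add_coset_eq_memI:
  assumes "add_subgroup H" "y \<in> add_coset H x"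
  shows "add_coset H y = add_coset H x"
  using assms by (simp add: add_coset_eq_iff) (simp add: add_coset_def)

lemma add_coset_translate: "add_coset H (d + x) = (+) d ` add_coset H x"
proof
  show "(+) d ` add_coset H x \<subseteq> add_coset H (d + x)" by (auto simp: add_coset_def)
  show "add_coset H (d + x) \<subseteq> (+) d ` add_coset H x"
  proof
    fix y assume "y \<in> add_coset H (d + x)"
    then have "y - d \<in> add_coset H x" by (simp add: add_coset_def algebra_simps)
    then show "y \<in> (+) d ` add_coset H x" by (force intro: image_eqI[of _ _ "y - d"])
  qed
qed

section \<open>Counting cosets: splitting and sieving\<close>

lemma range_add_coset_mono:
  assumes "add_subgroup M" "add_subgroup H" "M \<subseteq> H" "finite (range (add_coset M))"
  shows "finite (range (add_coset H))"
proof -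
  \<comment> \<open>An \<open>M\<close>-coset lies inside one \<open>H\<close>-coset, which any of
    its representatives recovers; so the \<open>H\<close>-cosets are an image of the
    \<open>M\<close>-cosets.\<close>
  have "add_coset H x = add_coset H (SOME y. y \<in> add_coset M x)" for x
  proof -
    have "(SOME y. y \<in> add_coset M x) \<in> add_coset M x"
      using add_coset_self[OF assms(1)] by (rule someI)
    then have "(SOME y. y \<in> add_coset M x) \<in> add_coset H x"
      using assms(3) unfolding add_coset_def by blast
    then show ?thesis by (rule add_coset_eq_memI[OF assms(2), symmetric])
  qed
  then have "range (add_coset H) \<subseteq> (\<lambda>c. add_coset H (SOME y. y \<in> c)) ` range (add_coset M)"
    by blast
  then show ?thesis using assms(4) by (meson finite_imageI finite_subset)
qed

text \<open>The \<open>H\<close>-cosets cut \<open>A\<close> into pieces, and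
  \<open>M \<subseteq> H\<close> keeps the \<open>M\<close>-cosets of different pieces apart. Since
  \<open>D\<close> meets every \<open>H\<close>-coset and preserves \<open>A\<close>, translation by
  elements of \<open>D\<close> carries the piece \<open>A \<inter> H\<close> onto every other
  piece.\<close>

lemma card_add_coset_image_split:
  fixes M H D A :: "'b::ab_group_add set"
  assumes M: "add_subgroup M" and H: "add_subgroup H" and D: "add_subgroup D"
    and MH: "M \<subseteq> H" and fin: "finite (range (add_coset M))"
    and DH: "\<And>x. \<exists>d\<in>D. x - d \<in> H"
    and AD: "\<And>x d. d \<in> D \<Longrightarrow> x \<in> A \<Longrightarrow> x + d \<in> A"
  shows "card (add_coset M ` A) = card (range (add_coset H)) * card (add_coset M ` (A \<inter> H))"
proof -
  have finH: "finite (range (add_coset H))" by (rule range_add_coset_mono[OF M H MH fin])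
  have finM: "finite (add_coset M ` X)" for X by (rule finite_subset[OF _ fin]) auto
  have eq: "add_coset M ` A = (\<Union>c\<in>range (add_coset H). add_coset M ` (A \<inter> c))"
    using add_coset_self[OF H] by blast
  have disj: "add_coset M ` (A \<inter> c) \<inter> add_coset M ` (A \<inter> c') = {}"
    if c: "c \<in> range (add_coset H)" and c': "c' \<in> range (add_coset H)" and ne: "c \<noteq> c'" for c c'
  proof (rule ccontr)
    assume "\<not> ?thesis"
    then obtain u v where uv: "u \<in> c" "v \<in> c'" "add_coset M u = add_coset M v" by blast
    then have "u - v \<in> H" using MH by (auto simp: add_coset_eq_iff[OF M])
    then have "add_coset H u = add_coset H v" by (simp add: add_coset_eq_iff[OF H])
    moreover have "c = add_coset H u" "c' = add_coset H v"
      using c c' uv add_coset_eq_memI[OF H] by blast+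
    ultimately show False using ne by simp
  qed
  have each: "card (add_coset M ` (A \<inter> c)) = card (add_coset M ` (A \<inter> H))"
    if "c \<in> range (add_coset H)" for c
  proof -
    from that obtain r where r: "c = add_coset H r" by auto
    obtain d where d: "d \<in> D" "r - d \<in> H" using DH by blast
    \<comment> \<open>The representative is moved into \<open>D\<close>, so that translation by it
      and by its negative maps \<open>A\<close> into itself.\<close>
    have c: "c = add_coset H d" using d r by (simp add: add_coset_eq_iff[OF H])
    have "A \<inter> c = (+) d ` (A \<inter> H)"
    proof
      show "A \<inter> c \<subseteq> (+) d ` (A \<inter> H)"
      proof
        fix x assume x: "x \<in> A \<inter> c"
        then have "x - d \<in> A \<inter> H"
          using AD[OF add_subgroup_minus[OF D d(1)], of x] by (auto simp: c add_coset_def)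
        then show "x \<in> (+) d ` (A \<inter> H)" by (force intro: image_eqI[of _ _ "x - d"])
      qed
      show "(+) d ` (A \<inter> H) \<subseteq> A \<inter> c"
        using AD[OF d(1)] by (auto simp: c add_coset_def add.commute)
    qed
    then have "add_coset M ` (A \<inter> c) = (`) ((+) d) ` (add_coset M ` (A \<inter> H))"
      by (simp add: image_image add_coset_translate)
    moreover have "inj ((`) ((+) d))" by (simp add: inj_image_eq_iff inj_def)
    ultimately show ?thesis by (metis card_image inj_on_subset subset_UNIV)
  qed
  have "card (add_coset M ` A) = (\<Sum>c\<in>range (add_coset H). card (add_coset M ` (A \<inter> c)))"
    unfolding eq using finH finM disj by (intro card_UN_disjoint) auto
  then show ?thesis using each by simp
qed

text \<open>The last assumption expresses independence: the intersection of the other subgroups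
  still meets every coset of \<open>H i\<close>. Hence \<open>H i\<close> contains exactly the
  fraction \<open>1 / [G : H i]\<close> of the cosets that survive the other conditions,
  \<open>G\<close> being the whole group, and each new condition contributes one factor.\<close>

lemma card_add_coset_sieve:
  fixes M :: "'b::ab_group_add set" and H :: "'i \<Rightarrow> 'b set"
  assumes M: "add_subgroup M" and fin: "finite (range (add_coset M))"
    and "finite S" and "\<And>i. i \<in> S \<Longrightarrow> add_subgroup (H i)" and "\<And>i. i \<in> S \<Longrightarrow> M \<subseteq> H i"
    and "\<And>i T x. i \<in> S \<Longrightarrow> T \<subseteq> S \<Longrightarrow> i \<notin> T \<Longrightarrow> \<exists>d\<in>(\<Inter>j\<in>T. H j). x - d \<in> H i"
  shows "real (card (add_coset M ` {x. \<forall>i\<in>S. x \<notin> H i})) =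
    real (card (range (add_coset M))) * (\<Prod>i\<in>S. 1 - inverse (real (card (range (add_coset (H i))))))"
  using assms(3-)
proof (induction S rule: finite_induct)
  case empty
  then show ?case by simp
next
  case (insert i S)
  let ?A = "{x. \<forall>i\<in>S. x \<notin> H i}" and ?D = "\<Inter>j\<in>S. H j"
  have Hi: "add_subgroup (H i)" "M \<subseteq> H i" using insert.prems by auto
  have D: "add_subgroup ?D" using insert.prems(1) by (auto simp: add_subgroup_def)
  \<comment> \<open>Shifting by an element of every \<open>H j\<close> does not change whether
    \<open>H j\<close> is avoided.\<close>
  have A: "x + d \<in> ?A" if "d \<in> ?D" "x \<in> ?A" for x d
    using that add_subgroup_diff_iff[OF insert.prems(1), of _ "x + d" x] by auto
  have DH: "\<exists>d\<in>?D. x - d \<in> H i" for x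
    using insert.prems(3)[of i S] insert.hyps by auto
  have split: "card (add_coset M ` ?A) =
      card (range (add_coset (H i))) * card (add_coset M ` (?A \<inter> H i))"
    by (rule card_add_coset_image_split[OF M Hi(1) D Hi(2) fin DH A])
  have finM: "finite (add_coset M ` X)" for X by (rule finite_subset[OF _ fin]) auto
  have pos: "card (range (add_coset (H i))) > 0"
    using range_add_coset_mono[OF M Hi fin] by (simp add: card_gt_0_iff)
  have "{x. \<forall>j\<in>insert i S. x \<notin> H j} = ?A - H i" by auto
  moreover have "add_coset M ` ?A = add_coset M ` (?A - H i) \<union> add_coset M ` (?A \<inter> H i)" by blast
  \<comment> \<open>As \<open>M \<subseteq> H i\<close>, an \<open>M\<close>-coset lies entirely
    inside or entirely outside \<open>H i\<close>.\<close>
  moreover have "add_coset M ` (?A - H i) \<inter> add_coset M ` (?A \<inter> H i) = {}"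
    using Hi add_subgroup_diff_iff[OF Hi(1)] by (auto simp: add_coset_eq_iff[OF M] image_iff)
  ultimately have "card (add_coset M ` ?A) =
      card (add_coset M ` {x. \<forall>j\<in>insert i S. x \<notin> H j}) + card (add_coset M ` (?A \<inter> H i))"
    using finM by (simp add: card_Un_disjoint)
  moreover have "real (card (add_coset M ` (?A \<inter> H i))) =
      real (card (add_coset M ` ?A)) * inverse (real (card (range (add_coset (H i)))))"
    using split pos by simp
  ultimately have "real (card (add_coset M ` {x. \<forall>j\<in>insert i S. x \<notin> H j})) =
      real (card (add_coset M ` ?A)) * (1 - inverse (real (card (range (add_coset (H i))))))"
    by (simp add: algebra_simps)
  also have "real (card (add_coset M ` ?A)) =
      real (card (range (add_coset M))) * (\<Prod>i\<in>S. 1 - inverse (real (card (range (add_coset (H i))))))"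
    using insert.prems by (intro insert.IH) (auto, blast)
  finally show ?case using insert.hyps by (simp add: mult_ac)
qed

section \<open>Cosets of products of subgroups\<close>

lemma add_subgroup_Times: "add_subgroup H \<Longrightarrow> add_subgroup K \<Longrightarrow> add_subgroup (H \<times> K)"
  by (auto simp: add_subgroup_def zero_prod_def)

lemma add_coset_Times: "add_coset (H \<times> K) (x, y) = add_coset H x \<times> add_coset K y"
  by (auto simp: add_coset_def)

lemma range_add_coset_Times:
  assumes "add_subgroup H" "add_subgroup K"
  shows "card (range (add_coset (H \<times> K))) = card (range (add_coset H)) * card (range (add_coset K))"
    and "finite (range (add_coset H)) \<Longrightarrow> finite (range (add_coset K)) \<Longrightarrow>
      finite (range (add_coset (H \<times> K)))"
proof -
  have *: "range (add_coset (H \<times> K)) = (\<lambda>(c, d). c \<times> d) ` (range (add_coset H) \<times> range (add_coset K))"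
  proof
    show "range (add_coset (H \<times> K)) \<subseteq> (\<lambda>(c, d). c \<times> d) ` (range (add_coset H) \<times> range (add_coset K))"
      by (force simp: add_coset_Times)
    show "(\<lambda>(c, d). c \<times> d) ` (range (add_coset H) \<times> range (add_coset K)) \<subseteq> range (add_coset (H \<times> K))"
      by (auto simp flip: add_coset_Times)
  qed
  \<comment> \<open>Cosets are nonempty, so a product of two cosets determines its factors.\<close>
  have "inj_on (\<lambda>(c, d). c \<times> d) (range (add_coset H) \<times> range (add_coset K))"
    using add_coset_self[OF assms(1)] add_coset_self[OF assms(2)]
    by (auto simp: inj_on_def times_eq_iff)
  then show "card (range (add_coset (H \<times> K))) = card (range (add_coset H)) * card (range (add_coset K))"
    unfolding * by (simp add: card_image card_cartesian_product)
  show "finite (range (add_coset (H \<times> K)))"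
    if "finite (range (add_coset H))" "finite (range (add_coset K))"
    unfolding * using that by blast
qed

subsection \<open>Ideals and unimodular pairs\<close>

text \<open>Translates ideals of the record into plain ring arithmetic, in which the later arguments
  are carried out.\<close>

lemma ideal_class_ring_iff:
  "ideal I (class_ring :: 'a::idom ring) \<longleftrightarrow> add_subgroup I \<and> (\<forall>r. \<forall>x\<in>I. r * x \<in> I)"
proof
  assume "ideal I (class_ring :: 'a ring)"
  then interpret ideal I "class_ring :: 'a ring" .
  have l: "r * x \<in> I" if "x \<in> I" for r x using I_l_closed[OF that, of r] by simp
  have "x - y \<in> I" if "x \<in> I" "y \<in> I" for x y
    using a_closed[OF that(1) l[OF that(2), of "-1"]] by simp
  moreover have "0 \<in> I" using zero_closed by simp
  ultimately show "add_subgroup I \<and> (\<forall>r. \<forall>x\<in>I. r * x \<in> I)" using l by (auto simp: add_subgroup_def)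
next
  assume I: "add_subgroup I \<and> (\<forall>r. \<forall>x\<in>I. r * x \<in> I)"
  show "ideal I (class_ring :: 'a ring)"
  proof (rule idealI)
    show "x \<otimes>\<^bsub>class_ring\<^esub> a \<in> I" "a \<otimes>\<^bsub>class_ring\<^esub> x \<in> I" if "a \<in> I" for a x :: 'a
      using I that by (simp_all add: mult.commute[of a x])
    show "ring (class_ring :: 'a ring)" by (rule class_ring.ring_axioms)
    show "subgroup I (add_monoid (class_ring :: 'a ring))"
    proof (rule group.subgroupI)
      show "group (add_monoid (class_ring :: 'a ring))" 
        by (rule abelian_group.a_group[OF ring.is_abelian_group[OF class_ring.ring_axioms]])
      show "inv\<^bsub>add_monoid class_ring\<^esub> x \<in> I" if "x \<in> I" for x
      proof -
        have "inv\<^bsub>add_monoid class_ring\<^esub> x = - x"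
          using class_ring_simps(8) by (metis a_inv_def)
        then show ?thesis using I that by (simp add: add_subgroup_minus)
      qed
    qed (use I in \<open>auto simp: add_subgroup_def intro: add_subgroup_add\<close>)
  qed
qed

lemma
  assumes "ideal I (class_ring :: 'a::idom ring)"
  shows ideal_add_subgroup: "add_subgroup I"
    and ideal_mult_left: "x \<in> I \<Longrightarrow> r * x \<in> I"
    and ideal_mult_right: "x \<in> I \<Longrightarrow> x * r \<in> I"
  using assms by (auto simp: ideal_class_ring_iff mult.commute)

lemma ideal_dvd: "ideal {x. m dvd x} (class_ring :: 'a::idom ring)"
  by (auto simp: ideal_class_ring_iff add_subgroup_def)

text \<open>The set is the sum of \<open>I\<close> and the principal ideal of \<open>x\<close>; in
  this form, membership of \<open>1\<close> is directly a Bezout relation modulo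
  \<open>I\<close>.\<close>

lemma ideal_adjoin:
  assumes "ideal I (class_ring :: 'a::idom ring)"
  shows "ideal {y. \<exists>r. y - r * x \<in> I} (class_ring :: 'a ring)" (is "ideal ?J _")
    and "I \<subseteq> {y. \<exists>r. y - r * x \<in> I}" and "x \<in> {y. \<exists>r. y - r * x \<in> I}"
proof -
  note I = assms[THEN ideal_add_subgroup]
  have "0 \<in> I" using I by (simp add: add_subgroup_def)
  then show "x \<in> ?J" by (auto intro: exI[of _ 1])
  show sub: "I \<subseteq> ?J" by (auto intro: exI[of _ 0])
  have "y - z \<in> ?J" if yz: "y \<in> ?J" "z \<in> ?J" for y z
  proof -
    obtain r s where "y - r * x \<in> I" "z - s * x \<in> I" using yz by blast
    from add_subgroup_diff[OF I this] have "(y - z) - (r - s) * x \<in> I" by (simp add: algebra_simps)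
    then show ?thesis by blast
  qed
  moreover have "r * y \<in> ?J" if y: "y \<in> ?J" for r y
  proof -
    obtain s where "y - s * x \<in> I" using y by blast
    from ideal_mult_left[OF assms this, of r] have "r * y - (r * s) * x \<in> I" by (simp add: algebra_simps)
    then show ?thesis by blast
  qed
  ultimately show "ideal ?J (class_ring :: 'a ring)"
    using sub \<open>0 \<in> I\<close> unfolding ideal_class_ring_iff add_subgroup_def by blast
qed

section \<open>Finite quotients and primes above an ideal\<close>

lemma carrier_class_ring_Quot: "carrier (class_ring Quot I) = range (add_coset I)"
  for I :: "'a::idom set"
proof -
  have "(\<Union>h\<in>I. {h + x}) = add_coset I x" for x
  proof
    show "(\<Union>h\<in>I. {h + x}) \<subseteq> add_coset I x" by (auto simp: add_coset_def)
    show "add_coset I x \<subseteq> (\<Union>h\<in>I. {h + x})"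
    proof
      fix y assume "y \<in> add_coset I x"
      then show "y \<in> (\<Union>h\<in>I. {h + x})" by (auto simp: add_coset_def intro: bexI[of _ "y - x"])
    qed
  qed
  then show ?thesis by (auto simp: FactRing_def A_RCOSETS_def' a_r_coset_def')
qed

lemma ideal_norm_eq_card: "ideal_norm I = card (range (add_coset I))"
  by (simp add: ideal_norm_def carrier_class_ring_Quot)

lemma finite_range_add_coset:
  assumes "norm_finite TYPE('a::idom)" "(m :: 'a) \<noteq> 0"
  shows "finite (range (add_coset {x. m dvd x}))"
  using assms by (simp add: norm_finite_def carrier_class_ring_Quot PIdl_class_ring)

text \<open>An ideal containing \<open>m\<close> is a union of cosets of the ideal generated by
  \<open>m\<close>, of which there are finitely many. A proper ideal above \<open>I\<close> with the
  most such cosets is therefore maximal, hence prime, and it is nonzero because it contains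
  \<open>m\<close>.\<close>

lemma exists_prime_above:
  fixes m :: "'a::idom"
  assumes nf: "norm_finite TYPE('a)" and m0: "m \<noteq> 0"
    and I: "ideal I (class_ring :: 'a ring)" and mI: "m \<in> I" and I1: "1 \<notin> I"
  shows "\<exists>P\<in>nonzero_primes. I \<subseteq> P"
proof -
  let ?M = "{x. m dvd x}"
  let ?ok = "\<lambda>J. ideal J (class_ring :: 'a ring) \<and> I \<subseteq> J \<and> 1 \<notin> J"
  note fin = finite_range_add_coset[OF nf m0]
  have finM: "finite (add_coset ?M ` X)" for X by (rule finite_subset[OF _ fin]) auto
  have M: "add_subgroup ?M" by (rule ideal_add_subgroup[OF ideal_dvd])
  have bound: "\<forall>J. ?ok J \<longrightarrow> card (add_coset ?M ` J) < Suc (card (range (add_coset ?M)))"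
    using fin by (auto simp: less_Suc_eq_le intro!: card_mono)
  have "?ok I" using I I1 by simp
  from ex_has_greatest_nat[of ?ok I "\<lambda>J. card (add_coset ?M ` J)", OF this bound]
  obtain P where P: "?ok P" and max: "\<And>J. ?ok J \<Longrightarrow> card (add_coset ?M ` J) \<le> card (add_coset ?M ` P)"
    by blast
  have "maximalideal P (class_ring :: 'a ring)"
  proof (rule maximalidealI)
    show "ideal P (class_ring :: 'a ring)" using P by simp
    show "carrier class_ring \<noteq> P" using P by auto
    fix J assume J: "ideal J (class_ring :: 'a ring)" "P \<subseteq> J"
    show "J = P \<or> J = carrier class_ring"
    proof (cases "1 \<in> J")
      case True
      then have "r \<in> J" for r using ideal_mult_left[OF J(1) True, of r] by simp
      then show ?thesis by auto
    next
      case False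
      \<comment> \<open>The left side is contained in the right and, by maximality of the count, has
        at least as many elements.\<close>
      have "add_coset ?M ` P = add_coset ?M ` J"
        using max[of J] J False P finM by (intro card_seteq) auto
      have "J \<subseteq> P"
      proof
        fix x assume "x \<in> J"
        then have "add_coset ?M x \<in> add_coset ?M ` P"
          using \<open>add_coset ?M ` P = add_coset ?M ` J\<close> by blast
        then obtain y where y: "y \<in> P" "m dvd x - y"
          by (auto simp: add_coset_eq_iff[OF M])
        then obtain k where "x - y = m * k" by (auto elim: dvdE)
        moreover have "m \<in> P" using P mI by blast
        ultimately have "x - y \<in> P" using P by (simp add: ideal_mult_right)
        then show "x \<in> P" using add_subgroup_diff_iff[of P x y] y(1) P ideal_add_subgroup by blast
      qed
      then show ?thesis using J by blast
    qed
  qed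
  then have "primeideal P (class_ring :: 'a ring)" by (rule cring.maximalideal_prime[OF class_cring.is_cring])
  then show ?thesis using P mI m0 by (auto simp: nonzero_primes_def)
qed

section \<open>Comaximal primes and unimodularity modulo m\<close>

lemma
  assumes "P \<in> (nonzero_primes :: 'a::idom set set)"
  shows nonzero_primes_ideal: "ideal P (class_ring :: 'a ring)"
    and nonzero_primes_one: "1 \<notin> P"
proof -
  interpret primeideal P "class_ring :: 'a ring" using assms by (simp add: nonzero_primes_def)
  show "ideal P (class_ring :: 'a ring)" by (rule is_ideal)
  show "1 \<notin> P" using one_imp_carrier I_notcarr by auto
qed

text \<open>Both primes are maximal. So \<open>Q\<close> has an element outside \<open>P\<close>,
  and adjoining it to \<open>P\<close> gives the whole ring.\<close>

lemma nonzero_primes_comaximal: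
  assumes dd: "dedekind_domain TYPE('a::idom)"
    and P: "P \<in> (nonzero_primes :: 'a set set)" and Q: "Q \<in> nonzero_primes" and ne: "P \<noteq> Q"
  shows "\<exists>e\<in>Q. 1 - e \<in> P"
proof -
  have max: "J = X \<or> J = UNIV"
    if "X \<in> nonzero_primes" "ideal J (class_ring :: 'a ring)" "X \<subseteq> J" for X J
    using dd that maximalideal.I_maximal[of X class_ring J] by (auto simp: dedekind_domain_def)
  have "\<not> Q \<subseteq> P"
    using max[OF Q nonzero_primes_ideal[OF P]] ne nonzero_primes_one[OF P] by blast
  then obtain x where x: "x \<in> Q" "x \<notin> P" by blast
  note J = ideal_adjoin[OF nonzero_primes_ideal[OF P], of x]
  have "{y. \<exists>r. y - r * x \<in> P} = UNIV" using max[OF P J(1,2)] J(3) x(2) by blast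
  then obtain r where "1 - r * x \<in> P" by blast
  then show ?thesis using ideal_mult_left[OF nonzero_primes_ideal[OF Q] x(1)] by blast
qed

text \<open>Multiplication by \<open>e\<close> fixes residues modulo \<open>P\<close> and kills
  those modulo each member of \<open>T\<close>; this supplies the independence assumption of the
  sieve. The induction multiplies the elements obtained for single primes.\<close>

lemma nonzero_primes_CRT:
  assumes dd: "dedekind_domain TYPE('a::idom)"
    and P: "P \<in> (nonzero_primes :: 'a set set)"
    and "finite T" "T \<subseteq> nonzero_primes" "P \<notin> T"
  shows "\<exists>e\<in>\<Inter>T. 1 - e \<in> P"
  using assms(3-)
proof (induction T rule: finite_induct)
  case empty
  then show ?case
    using ideal_add_subgroup[OF nonzero_primes_ideal[OF P]] by (auto simp: add_subgroup_def intro: exI[of _ 1])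
next
  case (insert Q T)
  then obtain e where e: "e \<in> \<Inter>T" "1 - e \<in> P" by auto
  obtain f where f: "f \<in> Q" "1 - f \<in> P"
    using nonzero_primes_comaximal[OF dd P, of Q] insert.prems by auto
  have "e * f \<in> \<Inter>(insert Q T)"
    using insert.prems(1) e(1) f(1) by (auto intro: ideal_mult_left ideal_mult_right dest: nonzero_primes_ideal)
  \<comment> \<open>The sum equals \<open>1 - e * f\<close>.\<close>
  moreover have "(1 - e) + e * (1 - f) \<in> P"
    using e(2) f(2) nonzero_primes_ideal[OF P]
    by (intro add_subgroup_add ideal_add_subgroup ideal_mult_left)
  ultimately show ?case by (auto simp: algebra_simps)
qed

text \<open>Unimodularity modulo \<open>m\<close> says that \<open>m\<close>, \<open>b\<close> and
  \<open>d\<close> generate the unit ideal, and a proper ideal containing \<open>m\<close> lies in a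
  nonzero prime. The case \<open>d = 0\<close> describes the units modulo \<open>m\<close>.\<close>

lemma unimodular_mod_iff:
  fixes m b d :: "'a::idom"
  assumes nf: "norm_finite TYPE('a)" and m0: "m \<noteq> 0"
  shows "(\<exists>x y. m dvd x * b + y * d - 1) \<longleftrightarrow>
    (\<forall>P\<in>{P \<in> nonzero_primes. m \<in> P}. \<not> (b \<in> P \<and> d \<in> P))"
proof
  assume "\<exists>x y. m dvd x * b + y * d - 1"
  then obtain x y z where xyz: "x * b + y * d - 1 = m * z" by (auto elim!: dvdE)
  show "\<forall>P\<in>{P \<in> nonzero_primes. m \<in> P}. \<not> (b \<in> P \<and> d \<in> P)"
  proof (intro ballI notI)
    fix P assume P: "P \<in> {P \<in> nonzero_primes. m \<in> P}" and bd: "b \<in> P \<and> d \<in> P"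
    have I: "ideal P (class_ring :: 'a ring)" using P nonzero_primes_ideal by blast
    note IP = ideal_add_subgroup[OF I]
    have "x * b \<in> P" "y * d \<in> P" "m * z \<in> P"
      using P bd by (auto intro: ideal_mult_left[OF I] ideal_mult_right[OF I])
    then have "x * b + y * d - m * z \<in> P"
      by (intro add_subgroup_diff[OF IP] add_subgroup_add[OF IP])
    moreover have "x * b + y * d - m * z = 1" using xyz by (simp add: algebra_simps)
    ultimately show False using P nonzero_primes_one by auto
  qed
next
  assume r: "\<forall>P\<in>{P \<in> nonzero_primes. m \<in> P}. \<not> (b \<in> P \<and> d \<in> P)"
  \<comment> \<open>Adjoining \<open>b\<close> and then \<open>d\<close> builds the ideal generated
    by \<open>m\<close>, \<open>b\<close> and \<open>d\<close>.\<close>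
  note J = ideal_adjoin[OF ideal_dvd[of m], of b]
  note K = ideal_adjoin[OF J(1), of d]
  let ?K = "{y. \<exists>r. y - r * d \<in> {y. \<exists>r. y - r * b \<in> {x. m dvd x}}}"
  have "m \<in> ?K" by (rule subsetD[OF K(2) subsetD[OF J(2)]]) simp
  have "1 \<in> ?K"
  proof (rule ccontr)
    assume "1 \<notin> ?K"
    from exists_prime_above[OF nf m0 K(1) \<open>m \<in> ?K\<close> this] obtain P
      where "P \<in> nonzero_primes" "?K \<subseteq> P" by blast
    moreover have "b \<in> ?K" "d \<in> ?K" by (rule subsetD[OF K(2) J(3)], rule K(3))
    ultimately show False using r \<open>m \<in> ?K\<close> by blast
  qed
  then obtain y x where "m dvd 1 - y * d - x * b" by blast
  then have "m dvd - (1 - y * d - x * b)" by (simp only: dvd_minus_iff)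
  then have "m dvd x * b + y * d - 1" by (simp add: algebra_simps)
  then show "\<exists>x y. m dvd x * b + y * d - 1" by blast
qed

section \<open>Idempotent powers and lifting of unimodular pairs\<close>

lemma ex_idempotent_power_mod:
  fixes b d :: "'a::idom"
  assumes fin: "finite (range (add_coset {x. d dvd x}))"
  shows "\<exists>n>0. d dvd b ^ n * b ^ n - b ^ n"
proof -
  have D: "add_subgroup {x. d dvd x}" by (rule ideal_add_subgroup[OF ideal_dvd])
  \<comment> \<open>By the pigeonhole principle the powers of \<open>b\<close> repeat modulo
    \<open>d\<close>, hence are periodic from exponent \<open>i\<close> on.\<close>
  have "\<not> inj (\<lambda>k::nat. add_coset {x. d dvd x} (b ^ k))"
  proof
    assume "inj (\<lambda>k::nat. add_coset {x. d dvd x} (b ^ k))"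
    moreover have "finite (range (\<lambda>k::nat. add_coset {x. d dvd x} (b ^ k)))"
      by (rule finite_subset[OF _ fin]) auto
    ultimately show False using finite_imageD by blast
  qed
  then obtain i j :: nat where ij: "i < j" "d dvd b ^ j - b ^ i"
    unfolding inj_def by (metis (mono_tags, lifting) D add_coset_eq_iff linorder_neqE_nat mem_Collect_eq)
  define p where "p = j - i"
  have p: "p > 0" "d dvd b ^ (i + p) - b ^ i" using ij by (simp_all add: p_def)
  have per: "d dvd b ^ (k + p * l) - b ^ k" if "k \<ge> i" for k l
  proof (induction l)
    case 0
    then show ?case by simp
  next
    case (Suc l)
    obtain t where t: "k + p * l = i + t" using \<open>k \<ge> i\<close> by (metis le_add1 le_iff_add le_trans)
    then have "k + p * Suc l = (i + p) + t" by simp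
    with t have "b ^ (k + p * Suc l) - b ^ (k + p * l) = b ^ t * (b ^ (i + p) - b ^ i)"
      by (simp only: power_add) (simp add: algebra_simps)
    then have "d dvd b ^ (k + p * Suc l) - b ^ (k + p * l)" using p(2) by simp
    from dvd_add[OF this Suc] have "d dvd b ^ (k + p * Suc l) - b ^ k"
      by (simp del: mult_Suc_right)
    then show ?case .
  qed
  \<comment> \<open>A positive multiple of the period that is at least \<open>i\<close>; so raising
    the exponent from \<open>n\<close> to \<open>n + n\<close> changes nothing modulo
    \<open>d\<close>. \<open>Suc\<close> keeps \<open>n\<close> positive when
    \<open>i = 0\<close>.\<close>
  define n where "n = p * Suc i"
  have "n > 0" "n \<ge> i" using p(1) by (cases p; simp add: n_def)+
  with per[of n "Suc i"] show ?thesis by (auto simp: n_def power_add intro!: exI[of _ n])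
qed

text \<open>
  Let \<open>e\<close> be an idempotent power of \<open>b\<close> modulo a nonzero \<open>d' \<equiv> d (mod m)\<close>. Where \<open>b\<close> is invertible, \<open>e\<close> is
  \<open>1\<close>, and where \<open>b\<close> is nilpotent, \<open>e\<close> is \<open>0\<close> and \<open>m\<close> is invertible; so \<open>b + (1 - e) m\<close> is
  invertible modulo \<open>d'\<close>.
\<close>

lemma unimodular_lift:
  fixes m b d :: "'a::idom"
  assumes nf: "norm_finite TYPE('a)" and m0: "m \<noteq> 0" and un: "m dvd x * b + y * d - 1"
  shows "\<exists>b' d' x' y'. m dvd b' - b \<and> m dvd d' - d \<and> x' * b' + y' * d' = 1"
proof -
  \<comment> \<open>Finiteness of the quotient needs a nonzero modulus; for \<open>d = 0\<close> the
    replacement \<open>m\<close> is congruent to \<open>d\<close> modulo \<open>m\<close> and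
    divides it.\<close>
  define d' where "d' = (if d = 0 then m else d)"
  have d': "d' \<noteq> 0" "d' dvd d" "m dvd d' - d" using m0 by (auto simp: d'_def)
  obtain n where n: "n > 0" "d' dvd b ^ n * b ^ n - b ^ n"
    using ex_idempotent_power_mod[OF finite_range_add_coset[OF nf d'(1)]] by blast
  define e where "e = b ^ n"
  define b' where "b' = b + (1 - e) * m"
  obtain z where z: "x * b + y * d - 1 = m * z" using un by (auto elim!: dvdE)
  \<comment> \<open>The ideal generated by \<open>b'\<close> and \<open>d'\<close>; the aim is to
    show that it contains \<open>1\<close>.\<close>
  let ?J = "{y. \<exists>r. y - r * b' \<in> {x. d' dvd x}}"
  note J = ideal_adjoin[OF ideal_dvd[of d'], of b']
  note add = add_subgroup_add[OF ideal_add_subgroup[OF J(1)]]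
    and sub = add_subgroup_diff[OF ideal_add_subgroup[OF J(1)]]
    and mul = ideal_mult_left[OF J(1)]
  have dJ: "a \<in> ?J" if "d' dvd a" for a using that J(2) by blast
  have ee: "e * e - e \<in> ?J" using n(2) by (intro dJ) (simp add: e_def)
  \<comment> \<open>This puts \<open>e * b\<close> into the ideal; multiplying by
    \<open>b ^ (n - 1)\<close> gives \<open>e * e\<close>, and idempotence then gives
    \<open>e\<close>.\<close>
  have "e * b' + m * (e * e - e) \<in> ?J" by (intro add mul J(3) ee)
  moreover have "e * b' + m * (e * e - e) = e * b" by (simp add: b'_def algebra_simps)
  ultimately have "b ^ (n - 1) * (e * b) \<in> ?J" by (simp only: mul)
  moreover have "b ^ (n - 1) * (e * b) = e * e"
    using n(1) unfolding e_def by (metis mult.assoc mult.commute power_minus_mult)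
  ultimately have "e * e - (e * e - e) \<in> ?J" using ee by (simp only: sub)
  then have eJ: "e \<in> ?J" by simp
  have "b' + m * e \<in> ?J" by (intro add mul J(3) eJ)
  moreover have "b' + m * e = b + m" by (simp add: b'_def algebra_simps)
  ultimately have bm: "b + m \<in> ?J" by simp
  \<comment> \<open>Modulo the ideal, \<open>d\<close> vanishes and \<open>m\<close> becomes
    \<open>- b\<close>, so the relation \<open>x * b + y * d = 1 + m * z\<close> makes
    \<open>w\<close> an inverse of \<open>b\<close>.\<close>
  define w where "w = x + z"
  have "y * d - z * (b + m) \<in> ?J" by (rule sub[OF mul[OF dJ[OF d'(2)]] mul[OF bm]])
  moreover have "y * d - z * (b + m) = 1 - b * w" using z by (simp add: w_def algebra_simps)
  \<comment> \<open>The geometric sum turns \<open>1 - b * w\<close> into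
    \<open>1 - (b * w) ^ n\<close>, whose last power is a multiple of \<open>e\<close> and so lies
    in the ideal.\<close>
  ultimately have "(1 - b * w) * (\<Sum>i<n. (b * w) ^ i) \<in> ?J" by (simp only: ideal_mult_right[OF J(1)])
  then have "1 - (b * w) ^ n \<in> ?J" by (simp only: one_diff_power_eq)
  then have "(1 - (b * w) ^ n) + w ^ n * e \<in> ?J" by (intro add mul eJ)
  then have "1 \<in> ?J" by (simp add: e_def power_mult_distrib mult.commute)
  then obtain r s where "1 - r * b' = d' * s" by (auto elim!: dvdE)
  then have "r * b' + s * d' = 1" by (simp add: algebra_simps)
  moreover have "m dvd b' - b" by (simp add: b'_def)
  ultimately show ?thesis using d'(3) by blast
qed

subsection \<open>Second columns of matrices in GL2\<close>

lemma carrier_GL2_mat: "A \<in> carrier GL2 \<Longrightarrow> A \<in> carrier_mat 2 2"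
  by (auto simp: GL2_simps Units_def ring_mat_simps)

lemma GL2_det_dvd_one:
  assumes "A \<in> carrier (GL2 :: 'a::idom mat monoid)"
  shows "A $$ (0,0) * A $$ (1,1) - A $$ (0,1) * A $$ (1,0) dvd 1"
proof -
  interpret group "GL2 :: 'a mat monoid" by (rule group_GL2)
  define B where "B = inv\<^bsub>GL2\<^esub> A"
  have BG: "B \<in> carrier GL2" using assms by (simp add: B_def)
  have AB: "A * B = 1\<^sub>m 2" using r_inv[OF assms] by (simp add: B_def GL2_simps)
  have e: "A $$ (i, 0) * B $$ (0, j) + A $$ (i, 1) * B $$ (1, j) = (if i = j then 1 else 0)"
    if "i < 2" "j < 2" for i j
    using that mat2_mult_entry[OF carrier_GL2_mat[OF assms] carrier_GL2_mat[OF BG] that] by (simp add: AB)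
  \<comment> \<open>Multiplicativity of the determinant; the four sums on the right are the entries
    of \<open>A * B\<close>.\<close>
  have "(A $$ (0,0) * A $$ (1,1) - A $$ (0,1) * A $$ (1,0)) *
      (B $$ (0,0) * B $$ (1,1) - B $$ (0,1) * B $$ (1,0)) =
    (A $$ (0, 0) * B $$ (0, 0) + A $$ (0, 1) * B $$ (1, 0)) *
      (A $$ (1, 0) * B $$ (0, 1) + A $$ (1, 1) * B $$ (1, 1)) -
    (A $$ (0, 0) * B $$ (0, 1) + A $$ (0, 1) * B $$ (1, 1)) *
      (A $$ (1, 0) * B $$ (0, 0) + A $$ (1, 1) * B $$ (1, 0))"
    by (simp add: algebra_simps)
  also have "\<dots> = 1" using e[of 0 0] e[of 0 1] e[of 1 0] e[of 1 1] by simp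
  finally show ?thesis by (rule dvdI[OF sym])
qed

lemma mat2_eqI:
  assumes "A \<in> carrier_mat 2 2" "B \<in> carrier_mat 2 2"
    and "\<And>i j. i < 2 \<Longrightarrow> j < 2 \<Longrightarrow> A $$ (i, j) = B $$ (i, j)"
  shows "A = B"
  using assms by (intro eq_matI) auto

lemma GL2_exists_snd_col:
  fixes b d :: "'a::idom"
  assumes "x * b + y * d = 1"
  shows "\<exists>A\<in>carrier GL2. A $$ (0,1) = b \<and> A $$ (1,1) = d"
proof -
  \<comment> \<open>The Bezout coefficients fill the first column so that the determinant is
    \<open>1\<close>; \<open>B\<close> is the adjugate.\<close>
  define A where "A = mat 2 2 (\<lambda>(i,j). if i = 0 then (if j = 0 then y else b) else (if j = 0 then - x else d))"
  define B where "B = mat 2 2 (\<lambda>(i,j). if i = 0 then (if j = 0 then d else - b) else (if j = 0 then x else y))"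
  have C: "A \<in> carrier_mat 2 2" "B \<in> carrier_mat 2 2" by (auto simp: A_def B_def)
  have "(A * B) $$ (i, j) = 1\<^sub>m 2 $$ (i, j)" "(B * A) $$ (i, j) = 1\<^sub>m 2 $$ (i, j)"
    if "i < 2" "j < 2" for i j
    using assms that mat2_mult_entry[OF C that] mat2_mult_entry[OF C(2,1) that]
    by (auto simp: less_2_cases_iff A_def B_def algebra_simps simp del: index_mult_mat)
  then have "A * B = 1\<^sub>m 2" "B * A = 1\<^sub>m 2" using C by (auto intro!: mat2_eqI)
  then have "A \<in> carrier GL2" using C by (auto simp: GL2_simps Units_def ring_mat_simps)
  moreover have "A $$ (0,1) = b" "A $$ (1,1) = d" by (auto simp: A_def)
  ultimately show ?thesis by blast
qed

lemma U0_iff_dvd: "A \<in> carrier GL2 \<Longrightarrow> A \<in> U0 m \<longleftrightarrow> m dvd A $$ (0,1)"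
  by (simp add: U0_def PIdl_class_ring)

text \<open>With \<open>B = A * C\<close>, the cross product of the second columns of
  \<open>A\<close> and \<open>B\<close> is the upper right entry of \<open>C\<close> times minus the
  determinant of \<open>A\<close>, which is a unit. Thus cosets agree when second columns are
  proportional modulo \<open>m\<close>.\<close>

lemma l_coset_U0_eq_iff:
  fixes m :: "'a::idom"
  assumes A: "A \<in> carrier GL2" and B: "B \<in> carrier GL2"
  shows "A <#\<^bsub>GL2\<^esub> U0 m = B <#\<^bsub>GL2\<^esub> U0 m \<longleftrightarrow>
    m dvd A $$ (0,1) * B $$ (1,1) - A $$ (1,1) * B $$ (0,1)"
proof -
  interpret group "GL2 :: 'a mat monoid" by (rule group_GL2)
  interpret U: subgroup "U0 m" "GL2 :: 'a mat monoid" by (rule subgroup_U0)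
  define C where "C = inv\<^bsub>GL2\<^esub> A \<otimes>\<^bsub>GL2\<^esub> B"
  have CG: "C \<in> carrier GL2" using A B by (simp add: C_def)
  have "A \<otimes>\<^bsub>GL2\<^esub> C = B" using A B by (simp add: C_def m_assoc[symmetric])
  then have AC: "A * C = B" by (simp add: GL2_simps)
  note e = mat2_mult_entry[OF carrier_GL2_mat[OF A] carrier_GL2_mat[OF CG], unfolded AC]
  let ?D = "A $$ (0,0) * A $$ (1,1) - A $$ (0,1) * A $$ (1,0)"
  have eq: "A $$ (0,1) * B $$ (1,1) - A $$ (1,1) * B $$ (0,1) = - (?D * C $$ (0,1))"
    using e[of 0 1] e[of 1 1] by (simp add: algebra_simps)
  obtain v where v: "1 = ?D * v" using GL2_det_dvd_one[OF A] by (rule dvdE)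
  have "m dvd ?D * C $$ (0,1) \<longleftrightarrow> m dvd C $$ (0,1)"
  proof
    assume "m dvd ?D * C $$ (0,1)"
    then have "m dvd v * (?D * C $$ (0,1))" by simp
    also have "v * (?D * C $$ (0,1)) = (?D * v) * C $$ (0,1)" by (simp only: ac_simps)
    finally show "m dvd C $$ (0,1)" by (simp only: v[symmetric] mult_1_left)
  qed simp
  moreover have "C \<in> U0 m \<longleftrightarrow> m dvd C $$ (0,1)" by (rule U0_iff_dvd[OF CG])
  ultimately have "m dvd A $$ (0,1) * B $$ (1,1) - A $$ (1,1) * B $$ (0,1) \<longleftrightarrow> C \<in> U0 m"
    by (simp only: eq dvd_minus_iff)
  also have "\<dots> \<longleftrightarrow> A <#\<^bsub>GL2\<^esub> U0 m = B <#\<^bsub>GL2\<^esub> U0 m"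
  proof
    assume "C \<in> U0 m"
    then have "B \<in> A <#\<^bsub>GL2\<^esub> U0 m"
      using U.lcos_module_rev[OF group_GL2 A B] by (simp add: C_def)
    then show "A <#\<^bsub>GL2\<^esub> U0 m = B <#\<^bsub>GL2\<^esub> U0 m"
      using l_repr_independence[OF _ A U.subgroup_axioms] by simp
  next
    assume "A <#\<^bsub>GL2\<^esub> U0 m = B <#\<^bsub>GL2\<^esub> U0 m"
    then have "B \<in> A <#\<^bsub>GL2\<^esub> U0 m" using lcos_self[OF B U.subgroup_axioms] by simp
    then show "C \<in> U0 m" unfolding C_def by (rule U.lcos_module_imp[OF group_GL2 A])
  qed
  finally show ?thesis ..
qed

lemma cross_dvd_of_proportional_mod:
  fixes m :: "'a::idom"
  assumes "m dvd v * u - 1" "m dvd v' * u' - 1" "m dvd u * b - u' * b'" "m dvd u * d - u' * d'"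
  shows "m dvd b * d' - d * b'"
proof -
  \<comment> \<open>The first term is the cross product times \<open>v * u * v' * u'\<close>, and
    the second removes the excess of that factor over \<open>1\<close>.\<close>
  have "b * d' - d * b' =
      v * v' * ((u * b - u' * b') * (u' * d') - (u * d - u' * d') * (u' * b')) -
      ((v * u - 1) * (v' * u') + (v' * u' - 1)) * (b * d' - d * b')"
    by (simp add: algebra_simps)
  also have "m dvd \<dots>"
    by (intro dvd_diff dvd_add dvd_mult[of _ _ "v * v'"] dvd_mult2[of _ _ "b * d' - d * b'"]
        assms[THEN dvd_mult2] assms)
  finally show ?thesis .
qed

lemma proportional_mod_of_cross_dvd:
  fixes m :: "'a::idom"
  assumes 1: "x * b + y * d = 1" and 2: "x' * b' + y' * d' = 1" and cross: "m dvd b * d' - d * b'"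
  shows "\<exists>u v. m dvd v * u - 1 \<and> m dvd u * b - b' \<and> m dvd u * d - d'"
proof -
  \<comment> \<open>The functional with coefficients \<open>x\<close>, \<open>y\<close> takes the
    value \<open>1\<close> on the first column, so on a multiple of that column it reads off the
    factor; \<open>?v\<close> does the same in the other direction.\<close>
  let ?u = "x * b' + y * d'" and ?v = "x' * b + y' * d"
  have "?v * ?u - (x * b + y * d) * (x' * b' + y' * d') = (y * x' - x * y') * (b * d' - d * b')"
    "?u * b - (x * b + y * d) * b' = y * (b * d' - d * b')"
    "?u * d - (x * b + y * d) * d' = - x * (b * d' - d * b')"
    by (simp_all add: algebra_simps)
  then have "m dvd ?v * ?u - 1" "m dvd ?u * b - b'" "m dvd ?u * d - d'"
    unfolding 1 2 mult_1_left using cross by (simp_all only: dvd_mult)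
  then show ?thesis by blast
qed

section \<open>Counting columns through cosets and units\<close>

lemma card_image_cong_kernel:
  assumes "\<And>x y. x \<in> A \<Longrightarrow> y \<in> A \<Longrightarrow> f x = f y \<longleftrightarrow> g x = g y"
  shows "card (f ` A) = card (g ` A)"
proof -
  \<comment> \<open>Both images are copies of \<open>A\<close> modulo the common kernel.\<close>
  have "bij_betw (\<lambda>c. g (inv_into A f c)) (f ` A) (g ` A)"
  proof (rule bij_betw_imageI)
    show "inj_on (\<lambda>c. g (inv_into A f c)) (f ` A)"
      by (rule inj_onI) (metis assms f_inv_into_f inv_into_into)
    have "g (inv_into A f (f x)) = g x" if "x \<in> A" for x
      using that by (metis assms f_inv_into_f imageI inv_into_into)
    then show "(\<lambda>c. g (inv_into A f c)) ` f ` A = g ` A" by (simp add: image_image)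
  qed
  then show ?thesis by (rule bij_betw_same_card)
qed

text \<open>A coset and a unit modulo \<open>m\<close> give the second column of the coset's
  representative scaled by the unit. Every unimodular column modulo \<open>m\<close> arises, and it
  determines both the coset and the residue of the unit.\<close>

lemma group_index_mult_card_units:
  fixes m :: "'a::idom"
  assumes nf: "norm_finite TYPE('a)" and m0: "m \<noteq> 0"
  shows "group_index GL2 (U0 m) * card (add_coset {x. m dvd x} ` {u. \<exists>v. m dvd v * u - 1}) =
    card (add_coset ({x. m dvd x} \<times> {x. m dvd x}) ` {(b, d). \<exists>x y. m dvd x * b + y * d - 1})"
    (is "_ * card (add_coset ?M ` ?U) = card (add_coset ?MM ` ?V)")
proof -
  let ?L = "lcosets\<^bsub>GL2\<^esub> (U0 m)"
  have M: "add_subgroup ?M" by (rule ideal_add_subgroup[OF ideal_dvd])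
  have MM: "add_subgroup ?MM" by (rule add_subgroup_Times[OF M M])
  define r where "r c = (SOME A. A \<in> carrier GL2 \<and> c = A <#\<^bsub>GL2\<^esub> U0 m)" for c
  have r: "r c \<in> carrier GL2" "r c <#\<^bsub>GL2\<^esub> U0 m = c" if "c \<in> ?L" for c
  proof -
    have "\<exists>A. A \<in> carrier GL2 \<and> c = A <#\<^bsub>GL2\<^esub> U0 m" using that by (auto simp: LCOSETS_def)
    from someI_ex[OF this] show "r c \<in> carrier GL2" "r c <#\<^bsub>GL2\<^esub> U0 m = c"
      unfolding r_def by simp_all
  qed
  have det: "\<exists>x y. x * r c $$ (0,1) + y * r c $$ (1,1) = 1" if c: "c \<in> ?L" for c
  proof -
    obtain v where "1 = (r c $$ (0,0) * r c $$ (1,1) - r c $$ (0,1) * r c $$ (1,0)) * v"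
      using GL2_det_dvd_one[OF r(1)[OF c]] by (rule dvdE)
    then have "(- r c $$ (1,0) * v) * r c $$ (0,1) + (r c $$ (0,0) * v) * r c $$ (1,1) = 1"
      by (simp add: algebra_simps)
    then show ?thesis by blast
  qed
  define F where "F = (\<lambda>(c, u). add_coset ?MM (u * r c $$ (0,1), u * r c $$ (1,1)))"
  define G where "G = (\<lambda>(c :: 'a mat set, u). (c, add_coset ?M u))"
  have "F z = F z' \<longleftrightarrow> G z = G z'" if zz: "z \<in> ?L \<times> ?U" "z' \<in> ?L \<times> ?U" for z z'
  proof -
    obtain c u c' u' where z: "z = (c, u)" "z' = (c', u')" by (cases z, cases z') auto
    with zz have cu: "c \<in> ?L" "c' \<in> ?L" and "u \<in> ?U" "u' \<in> ?U" by auto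
    then obtain v v' where v: "m dvd v * u - 1" "m dvd v' * u' - 1" by blast
    let ?b = "r c $$ (0,1)" and ?d = "r c $$ (1,1)" and ?b' = "r c' $$ (0,1)" and ?d' = "r c' $$ (1,1)"
    have F: "F z = F z' \<longleftrightarrow> m dvd u * ?b - u' * ?b' \<and> m dvd u * ?d - u' * ?d'"
      by (simp add: F_def z add_coset_eq_iff[OF MM])
    have G: "G z = G z' \<longleftrightarrow> c = c' \<and> m dvd u - u'"
      by (simp add: G_def z add_coset_eq_iff[OF M])
    have "c = c' \<and> m dvd u - u'"
      if *: "m dvd u * ?b - u' * ?b'" "m dvd u * ?d - u' * ?d'"
    proof -
      have "m dvd ?b * ?d' - ?d * ?b'" by (rule cross_dvd_of_proportional_mod[OF v that])
      then have c: "c = c'" using l_coset_U0_eq_iff[OF r(1)[OF cu(1)] r(1)[OF cu(2)], of m]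
        by (simp only: r(2)[OF cu(1)] r(2)[OF cu(2)])
      obtain x y where xy: "x * ?b + y * ?d = 1" using det[OF cu(1)] by blast
      \<comment> \<open>The Bezout functional of the common column extracts
        \<open>u - u'\<close>.\<close>
      have "m dvd x * (u * ?b - u' * ?b') + y * (u * ?d - u' * ?d')" using * by simp
      also have "\<dots> = (u - u') * (x * ?b + y * ?d)" by (simp add: c algebra_simps)
      finally show ?thesis using c xy by simp
    qed
    moreover have "m dvd u * ?b - u' * ?b' \<and> m dvd u * ?d - u' * ?d'" if "c = c'" "m dvd u - u'"
      using that by (auto simp flip: left_diff_distrib)
    ultimately show ?thesis unfolding F G by blast
  qed
  then have "card (F ` (?L \<times> ?U)) = card (G ` (?L \<times> ?U))" by (rule card_image_cong_kernel)
  moreover have "G ` (?L \<times> ?U) = ?L \<times> add_coset ?M ` ?U" by (force simp: G_def)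
  moreover have "F ` (?L \<times> ?U) = add_coset ?MM ` ?V"
  proof
    show "F ` (?L \<times> ?U) \<subseteq> add_coset ?MM ` ?V"
    proof clarify
      fix c u v assume c: "c \<in> ?L" and v: "m dvd v * u - 1"
      obtain x y where "x * r c $$ (0,1) + y * r c $$ (1,1) = 1" using det[OF c] by blast
      moreover have "(v * x) * (u * r c $$ (0,1)) + (v * y) * (u * r c $$ (1,1)) =
          v * u * (x * r c $$ (0,1) + y * r c $$ (1,1))" by (simp add: algebra_simps)
      ultimately have "m dvd (v * x) * (u * r c $$ (0,1)) + (v * y) * (u * r c $$ (1,1)) - 1"
        using v by simp
      then have "(u * r c $$ (0,1), u * r c $$ (1,1)) \<in> ?V" by blast
      then show "F (c, u) \<in> add_coset ?MM ` ?V" by (simp add: F_def)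
    qed
    show "add_coset ?MM ` ?V \<subseteq> F ` (?L \<times> ?U)"
    proof clarify
      fix b d x y assume "m dvd x * b + y * d - 1"
      from unimodular_lift[OF nf m0 this] obtain b' d' x' y'
        where bd': "m dvd b' - b" "m dvd d' - d" "x' * b' + y' * d' = 1" by blast
      obtain A where A: "A \<in> carrier GL2" "A $$ (0,1) = b'" "A $$ (1,1) = d'"
        using GL2_exists_snd_col[OF bd'(3)] by blast
      \<comment> \<open>The representative of this coset may differ from \<open>A\<close>, but its
        second column is proportional to that of \<open>A\<close> modulo \<open>m\<close>; the
        factor is the required unit.\<close>
      define c where "c = A <#\<^bsub>GL2\<^esub> U0 m"
      have c: "c \<in> ?L" using A(1) by (auto simp: c_def LCOSETS_def)
      let ?b = "r c $$ (0,1)" and ?d = "r c $$ (1,1)"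
      have cross: "m dvd ?b * d' - ?d * b'"
        using l_coset_U0_eq_iff[OF r(1)[OF c] A(1)] r(2)[OF c] A by (simp add: c_def)
      obtain s t where st: "s * ?b + t * ?d = 1" using det[OF c] by blast
      obtain u v where "m dvd v * u - 1" and u: "m dvd u * ?b - b'" "m dvd u * ?d - d'"
        using proportional_mod_of_cross_dvd[OF st bd'(3) cross] by blast
      then have "u \<in> ?U" by blast
      have "m dvd u * ?b - b" "m dvd u * ?d - d"
        using dvd_add[OF u(1) bd'(1)] dvd_add[OF u(2) bd'(2)] by simp_all
      then have "F (c, u) = add_coset ?MM (b, d)" by (simp add: F_def add_coset_eq_iff[OF MM])
      moreover have "(c, u) \<in> ?L \<times> ?U" using c \<open>u \<in> ?U\<close> by blast
      ultimately show "add_coset ?MM (b, d) \<in> F ` (?L \<times> ?U)" by (metis imageI)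
    qed
  qed
  ultimately show ?thesis by (simp add: group_index_def card_cartesian_product)
qed

theorem corollary4p1:
  fixes m :: "'a::idom"
  assumes "dedekind_domain TYPE('a)"
    and "norm_finite TYPE('a)"
    and "m \<noteq> 0"
  shows "real (group_index (GL2 :: 'a mat monoid) (U0 m)) =
    real (ideal_norm (PIdl\<^bsub>class_ring\<^esub> m)) *
    (\<Prod>P\<in>{P \<in> nonzero_primes. m \<in> P}. 1 + inverse (real (ideal_norm P)))"
proof -
  let ?M = "{x. m dvd x}" and ?S = "{P \<in> nonzero_primes. m \<in> P}"
  define N where "N = real (card (range (add_coset ?M)))"
  define q where "q P = real (card (range (add_coset P)))" for P :: "'a set"
  have M: "add_subgroup ?M" by (rule ideal_add_subgroup[OF ideal_dvd])
  note finM = finite_range_add_coset[OF assms(2,3)]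
  have finS: "finite ?S" by (rule finite_nonzero_primes_dvd[OF assms(2,3)])
  have P: "ideal P (class_ring :: 'a ring)" "add_subgroup P" "?M \<subseteq> P" if "P \<in> ?S" for P
  proof -
    show I: "ideal P (class_ring :: 'a ring)" using that nonzero_primes_ideal by blast
    show "add_subgroup P" by (rule ideal_add_subgroup[OF I])
    show "?M \<subseteq> P" using that ideal_mult_right[OF I] by (auto elim!: dvdE)
  qed
  have CRT: "\<exists>e\<in>\<Inter>T. 1 - e \<in> P" if "P \<in> ?S" "T \<subseteq> ?S" "P \<notin> T" for P T
    using nonzero_primes_CRT[OF assms(1), of P T] that finite_subset[OF that(2) finS] by blast
  have N0: "N > 0" using finM by (simp add: N_def card_gt_0_iff)
  \<comment> \<open>The cosets of \<open>0\<close> and \<open>1\<close> differ, so no factor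
    \<open>1 - inverse (q P)\<close> vanishes in the final cancellation.\<close>
  have q1: "q P > 1" if "P \<in> ?S" for P
  proof -
    have "finite (range (add_coset P))" using range_add_coset_mono[OF M P(2,3)[OF that] finM] .
    moreover have "add_coset P 1 \<noteq> add_coset P 0"
      using that nonzero_primes_one by (auto simp: add_coset_eq_iff[OF P(2)[OF that]])
    ultimately have "card {add_coset P 1, add_coset P 0} \<le> card (range (add_coset P))"
      by (intro card_mono) auto
    with \<open>add_coset P 1 \<noteq> add_coset P 0\<close> show ?thesis by (simp add: q_def)
  qed
  have "{u. \<exists>v. m dvd v * u - 1} = {u. \<forall>P\<in>?S. u \<notin> P}"
  proof -
    \<comment> \<open>Units are the unimodular pairs with second entry \<open>0\<close>, which lies
      in every prime.\<close>
    have "(\<exists>v. m dvd v * u - 1) \<longleftrightarrow> (\<exists>v w. m dvd v * u + w * 0 - 1)" for u by simp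
    moreover have "0 \<in> P" if "P \<in> ?S" for P using P(2)[OF that] by (simp add: add_subgroup_def)
    ultimately show ?thesis by (simp only: unimodular_mod_iff[OF assms(2,3)]) blast
  qed
  moreover have "real (card (add_coset ?M ` {u. \<forall>P\<in>?S. u \<notin> P})) = N * (\<Prod>P\<in>?S. 1 - inverse (q P))"
    unfolding N_def q_def
  proof (rule card_add_coset_sieve[OF M finM finS P(2,3)])
    fix P T and x :: 'a assume T: "P \<in> ?S" "T \<subseteq> ?S" "P \<notin> T"
    obtain e where e: "e \<in> \<Inter>T" "1 - e \<in> P" using CRT[OF T] by blast
    have "x * e \<in> (\<Inter>P\<in>T. P)" using e(1) T(2) ideal_mult_left[OF P(1)] by auto
    moreover have "x - x * e \<in> P"
      using ideal_mult_left[OF P(1)[OF T(1)] e(2), of x] by (simp add: algebra_simps)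
    ultimately show "\<exists>d\<in>\<Inter>P\<in>T. P. x - d \<in> P" by (rule bexI[rotated])
  qed
  ultimately have units:
    "real (card (add_coset ?M ` {u. \<exists>v. m dvd v * u - 1})) = N * (\<Prod>P\<in>?S. 1 - inverse (q P))"
    by (simp only:)
  have "{(b, d). \<exists>x y. m dvd x * b + y * d - 1} = {z. \<forall>P\<in>?S. z \<notin> P \<times> P}"
    unfolding unimodular_mod_iff[OF assms(2,3)] by auto
  moreover have "real (card (add_coset (?M \<times> ?M) ` {z. \<forall>P\<in>?S. z \<notin> P \<times> P})) =
      real (card (range (add_coset (?M \<times> ?M)))) *
      (\<Prod>P\<in>?S. 1 - inverse (real (card (range (add_coset (P \<times> P))))))"
  proof (rule card_add_coset_sieve[OF add_subgroup_Times[OF M M] _ finS add_subgroup_Times[OF P(2,2)]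
        Sigma_mono[OF P(3,3)]])
    show "finite (range (add_coset (?M \<times> ?M)))" by (rule range_add_coset_Times(2)[OF M M finM finM])
    fix P T and z :: "'a \<times> 'a" assume T: "P \<in> ?S" "T \<subseteq> ?S" "P \<notin> T"
    obtain e where e: "e \<in> \<Inter>T" "1 - e \<in> P" using CRT[OF T] by blast
    \<comment> \<open>The same \<open>e\<close> serves both components, so independence passes to
      the squares of the primes.\<close>
    have "(fst z * e, snd z * e) \<in> (\<Inter>P\<in>T. P \<times> P)"
      using e(1) T(2) ideal_mult_left[OF P(1)] by auto
    moreover have "x - x * e \<in> P" for x
      using ideal_mult_left[OF P(1)[OF T(1)] e(2), of x] by (simp add: algebra_simps)
    then have "z - (fst z * e, snd z * e) \<in> P \<times> P" by (cases z) simp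
    ultimately show "\<exists>d\<in>\<Inter>P\<in>T. P \<times> P. z - d \<in> P \<times> P" by (rule bexI[rotated])
  qed
  moreover have "real (card (range (add_coset (?M \<times> ?M)))) = N\<^sup>2"
    by (simp add: range_add_coset_Times(1)[OF M M] N_def power2_eq_square)
  moreover have "(\<Prod>P\<in>?S. 1 - inverse (real (card (range (add_coset (P \<times> P)))))) =
      (\<Prod>P\<in>?S. 1 - inverse ((q P)\<^sup>2))"
    using range_add_coset_Times(1)[OF P(2) P(2)]
    by (intro prod.cong refl) (simp add: q_def power2_eq_square)
  ultimately have vecs: "real (card (add_coset (?M \<times> ?M) ` {(b, d). \<exists>x y. m dvd x * b + y * d - 1})) =
      N\<^sup>2 * (\<Prod>P\<in>?S. 1 - inverse ((q P)\<^sup>2))"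
    by (simp only:)
  \<comment> \<open>The difference of squares splits off the factor belonging to the unit count,
    leaving the factor of the index.\<close>
  have "1 - inverse ((q P)\<^sup>2) = (1 + inverse (q P)) * (1 - inverse (q P))" for P
    by (simp add: algebra_simps power2_eq_square)
  then have "(\<Prod>P\<in>?S. 1 - inverse ((q P)\<^sup>2)) =
      (\<Prod>P\<in>?S. 1 + inverse (q P)) * (\<Prod>P\<in>?S. 1 - inverse (q P))"
    by (simp add: prod.distrib)
  moreover have "real (group_index GL2 (U0 m)) * (N * (\<Prod>P\<in>?S. 1 - inverse (q P))) =
      N\<^sup>2 * (\<Prod>P\<in>?S. 1 - inverse ((q P)\<^sup>2))"
    using group_index_mult_card_units[OF assms(2,3), THEN arg_cong[of _ _ real]]
    unfolding of_nat_mult units vecs .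
  ultimately have "real (group_index GL2 (U0 m)) * (N * (\<Prod>P\<in>?S. 1 - inverse (q P))) =
      N * (\<Prod>P\<in>?S. 1 + inverse (q P)) * (N * (\<Prod>P\<in>?S. 1 - inverse (q P)))"
    by (simp only: power2_eq_square ac_simps)
  moreover have "1 - inverse (q P) \<noteq> 0" if "P \<in> ?S" for P using q1[OF that] by simp
  then have "N * (\<Prod>P\<in>?S. 1 - inverse (q P)) \<noteq> 0" using N0 finS by simp
  ultimately have "real (group_index GL2 (U0 m)) = N * (\<Prod>P\<in>?S. 1 + inverse (q P))"
    by (simp only: mult_cancel_right) simp
  then show ?thesis by (simp add: N_def q_def ideal_norm_eq_card PIdl_class_ring)
qed

end
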